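(* The function $y=\sigma_3(z)$ satisfies on $|z|<1$ the ordinary differential equation $$\big(y^2y'''-15\,y\,y'\,y''+30(y')^3\big)^2+32\big(y\,y''-3(y')^2\big)^3=4\pi^2\,y^{10}\big(y\,y''-3(y')^2\big)^2,$$ where primes denote derivatives with respect to $z$.
   Context: The Jacobi theta constant is $\theta_3(x)=\sum_{n=-\infty}^\infty e^{-\pi n^2 x}$ for $\operatorname{Re}(x)>0$. The function $\sigma_3$ is defined by $\sigma_3(z)=\dfrac{1}{\sqrt{1+z}}\,\theta_3\!\left(\dfrac{1-z}{1+z}\right)$ for $|z|<1$ (principal square root). *)

theory Defs
  imports "HOL-Complex_Analysis.Complex_Analysis"
begin

text \<open>The series converges absolutely for \<open>Re x > 0\<close>; values of \<open>theta3\<close> elsewhere, and hence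
  of \<open>sigma3\<close> outside the open unit disc, carry no meaning.\<close>

definition theta3 :: "complex \<Rightarrow> complex" where
  "theta3 x = (\<Sum>\<^sub>\<infinity>n::int. exp (- of_real pi * of_int n ^ 2 * x))"

definition sigma3 :: "complex \<Rightarrow> complex" where
  "sigma3 z = 1 / csqrt (1 + z) * theta3 ((1 - z) / (1 + z))"

end

theory Submission
  imports Defs
begin

text \<open>In the nome \<open>q = exp (- \<pi> x)\<close> put \<open>a = \<Sum> q ^ (n\<^sup>2)\<close>, \<open>b(q) = a(-q)\<close> and \<open>D = q d/dq\<close>.
  Rotating the square lattice by 45 degrees in the double series shows that \<open>q \<mapsto> q\<^sup>2\<close> is one step of
  the arithmetic-geometric mean, \<open>2 a(q\<^sup>2)\<^sup>2 = a\<^sup>2 + b\<^sup>2\<close> and \<open>b(q\<^sup>2)\<^sup>2 = a b\<close>. Comparing logarithmic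
  derivatives along \<open>q, q\<^sup>2, q ^ 4, \<dots> \<longlongrightarrow> 0\<close>, this and \<open>a = 1 + 2 q + \<dots>\<close> force,
  with \<open>P = D a / a\<close> and \<open>R = D b / b\<close>,
  \<open>4 (P - R) = a ^ 4 - b ^ 4\<close> and \<open>D P = 2 P\<^sup>2 + b ^ 4 (a ^ 4 - b ^ 4) / 8\<close>.
  So \<open>D\<close> acts on polynomials in \<open>a, b, P\<close>, and the differential equation for \<open>a\<close> with respect to
  \<open>D\<close> is a polynomial identity. Both sides of the equation are covariant under the substitution
  \<open>x = (1 - z) / (1 + z)\<close> with weight factor \<open>(1 + z) powr (-1/2)\<close>.\<close>

section \<open>The theta series in the nome and the arithmetic-geometric mean\<close>

text \<open>Natural exponents make this a power series that also has a value at
  \<open>q = 0\<close>, the point to which repeated squaring converges.\<close>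

definition theta_nome :: "complex \<Rightarrow> complex" where
  "theta_nome q = (\<Sum>\<^sub>\<infinity>n::int. q ^ nat (n ^ 2))"

section \<open>Absolute convergence of the theta series and of products of two of them\<close>

lemma summable_on_power_nat_square:
  fixes r :: real
  assumes "0 \<le> r" "r < 1"
  shows "(\<lambda>n::int. r ^ nat (n ^ 2)) summable_on UNIV"
proof -
  have "(\<lambda>n::nat. r ^ n) summable_on UNIV"
    using assms by (subst summable_on_UNIV_nonneg_real_iff) auto
  then have nat: "(\<lambda>n::nat. r ^ (n ^ 2)) summable_on UNIV"
    using assms
    by (elim summable_on_comparison_test) (auto intro!: power_decreasing simp: power2_eq_square)
  have "inj (\<lambda>n::nat. - int n)" "inj int"
    by (auto simp: inj_def)
  moreover have "nat (int n ^ 2) = n ^ 2" for n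
    by (simp flip: of_nat_power)
  ultimately have "(\<lambda>n::int. r ^ nat (n ^ 2)) summable_on range int"
    "(\<lambda>n::int. r ^ nat (n ^ 2)) summable_on range (\<lambda>n. - int n)"
    using nat by (simp_all add: summable_on_reindex o_def)
  moreover have "(UNIV :: int set) = range int \<union> range (\<lambda>n. - int n)"
  proof (intro UNIV_eq_I)
    show "n \<in> range int \<union> range (\<lambda>n. - int n)" for n
      by (cases n rule: int_cases2) auto
  qed
  ultimately show ?thesis
    by (metis summable_on_union)
qed

lemma abs_summable_on_power_nat_square:
  fixes q :: complex
  assumes "norm q < 1"
  shows "(\<lambda>n::int. norm (q ^ nat (n ^ 2))) summable_on UNIV"
  using summable_on_power_nat_square[of "norm q"] assms by (simp add: norm_power)

text \<open>Absolute convergence allows the product to be rearranged freely as one sum over the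
  square lattice. The nomes are kept apart because \<open>q\<close> and \<open>- q\<close> get
  multiplied.\<close>

lemma theta_nome_mult_has_sum:
  fixes p q :: complex
  assumes "norm p < 1" "norm q < 1"
  shows "((\<lambda>(m, n). p ^ nat (m ^ 2) * q ^ nat (n ^ 2)) has_sum theta_nome p * theta_nome q) UNIV"
proof -
  let ?h = "\<lambda>(m::int, n::int). p ^ nat (m ^ 2) * q ^ nat (n ^ 2)"
  have p: "(\<lambda>n::int. norm (p ^ nat (n ^ 2))) summable_on UNIV"
    and q: "(\<lambda>n::int. norm (q ^ nat (n ^ 2))) summable_on UNIV"
    using assms by (auto intro: abs_summable_on_power_nat_square)
  have "(\<lambda>x. norm (?h x)) summable_on UNIV \<times> UNIV"
    unfolding Infinite_Sum.abs_summable_on_Sigma_iff[where f = ?h]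
    using p q by (auto simp: infsum_cmult_right' abs_mult norm_mult
        intro!: summable_on_cmult_right summable_on_cmult_left)
  then have s: "?h summable_on UNIV \<times> UNIV"
    by (rule abs_summable_summable)
  moreover have "infsum ?h (UNIV \<times> UNIV) = theta_nome p * theta_nome q"
    using infsum_Sigma'_banach[OF s] by (simp add: theta_nome_def infsum_cmult_left' infsum_cmult_right')
  ultimately show ?thesis
    by (metis UNIV_Times_UNIV has_sum_infsum)
qed

lemma theta_nome_mult_summable:
  fixes p q :: complex
  assumes "norm p < 1" "norm q < 1"
  shows "(\<lambda>(m, n). p ^ nat (m ^ 2) * q ^ nat (n ^ 2)) summable_on X"
  using theta_nome_mult_has_sum[OF assms] by (meson summable_on_def summable_on_subset_banach top_greatest)

section \<open>Rotation of the square lattice and the two means\<close>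

lemma minus_power_nat_square:
  "(- q) ^ nat (n ^ 2) = (if even n then 1 else -1) * (q :: complex) ^ nat (n ^ 2)"
proof -
  have "even (nat (n ^ 2)) = even n"
    by (simp add: even_nat_iff)
  moreover have "(if even n then 1 else -1) * q ^ nat (n ^ 2)
      = (if even n then q ^ nat (n ^ 2) else - (q ^ nat (n ^ 2)))"
    by simp
  ultimately show ?thesis
    using power_minus_even[of "nat (n ^ 2)" q] power_minus_odd[of "nat (n ^ 2)" q] by metis
qed

text \<open>This rests on \<open>2 i^2 + 2 j^2 = (i + j)^2 + (i - j)^2\<close>; the factor
  \<open>c\<close> will carry a sign.\<close>

lemma power_nat_square_rotate:
  "(c * q ^ 2) ^ nat (i ^ 2) * (c * q ^ 2) ^ nat (j ^ 2)
     = (c::complex) ^ (nat (i ^ 2) + nat (j ^ 2)) * (q ^ nat ((i + j) ^ 2) * q ^ nat ((i - j) ^ 2))"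
proof -
  have "int (2 * nat (i ^ 2) + 2 * nat (j ^ 2)) = int (nat ((i + j) ^ 2) + nat ((i - j) ^ 2))"
    using zero_le_power2[of "i + j"] zero_le_power2[of "i - j"]
    by (simp only: of_nat_add of_nat_mult nat_0_le zero_le_power2) (simp add: power2_sum power2_diff)
  then have "2 * nat (i ^ 2) + 2 * nat (j ^ 2) = nat ((i + j) ^ 2) + nat ((i - j) ^ 2)"
    by linarith
  then have "(q ^ 2) ^ nat (i ^ 2) * (q ^ 2) ^ nat (j ^ 2) = q ^ nat ((i + j) ^ 2) * q ^ nat ((i - j) ^ 2)"
    by (metis power_add power_mult)
  then show ?thesis
    unfolding power_mult_distrib power_add by (simp add: algebra_simps)
qed

text \<open>The sublattice of index two that the rotated lattice fills.\<close>

definition even_pairs :: "(int \<times> int) set" where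
  "even_pairs = {(m, n). even (m + n)}"

lemma bij_betw_rotate: "bij_betw (\<lambda>(i, j). (i + j, i - j)) UNIV even_pairs"
proof (rule bij_betwI[where g = "\<lambda>(m, n). ((m + n) div 2, (m - n) div 2)"])
  show "(\<lambda>(i, j). (i + j, i - j)) (case x of (m, n) \<Rightarrow> ((m + n) div 2, (m - n) div 2)) = x"
    if x: "x \<in> even_pairs" for x
  proof -
    obtain m n where mn: "x = (m, n)" "even (m + n)"
      using x unfolding even_pairs_def by blast
    obtain k where "m + n = 2 * k"
      using mn(2) by (rule evenE)
    with mn(1) have "x = (2 * k - n, n)"
      by simp
    moreover have "(2 * k - n - n) div 2 = k - n"
      by simp
    ultimately show ?thesis
      by simp
  qed
qed (auto simp: even_pairs_def)

text \<open>The product at \<open>q\<close> and \<open>c * q\<close> splits into the sum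
  \<open>S c\<close> over the sublattice and the sum \<open>T c\<close> over its complement.
  Rotation identifies \<open>S c\<close> with the square at \<open>c * q ^ 2\<close>, and the
  complement is removed by its signs.\<close>

lemma theta_nome_agm:
  assumes q: "norm q < 1"
  shows theta_nome_geometric_mean:
      "theta_nome (- (q ^ 2)) ^ 2 = theta_nome q * theta_nome (- q)"
    and theta_nome_arithmetic_mean:
      "2 * theta_nome (q ^ 2) ^ 2 = theta_nome q ^ 2 + theta_nome (- q) ^ 2"
proof -
  define h where "h c = (\<lambda>(m, n). q ^ nat (m ^ 2) * (c * q) ^ nat (n ^ 2))" for c :: complex
  define S where "S c = infsum (h c) even_pairs" for c
  define T where "T c = infsum (h c) (- even_pairs)" for c
  \<comment> \<open>On the sublattice the two signs agree; off it exactly one coordinate is odd, so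
    a single sign survives and a swap moves it to the other factor.\<close>
  have signs: "(m, n) \<in> even_pairs \<Longrightarrow> (-q) ^ nat (m ^ 2) * (-q) ^ nat (n ^ 2) = h 1 (m, n)"
    "(m, n) \<notin> even_pairs \<Longrightarrow> (-q) ^ nat (m ^ 2) * (-q) ^ nat (n ^ 2) = - h 1 (m, n)"
    "(m, n) \<notin> even_pairs \<Longrightarrow> h (-1) (n, m) = - h (-1) (m, n)" for m n
    by (cases "even m"; cases "even n"; simp add: h_def even_pairs_def minus_power_nat_square)+
  have q2: "norm (q ^ 2) < 1"
    using q by (simp add: norm_power power_less_one_iff)
  have hs: "h c summable_on X" if "c = 1 \<or> c = -1" for X c
    unfolding h_def by (rule theta_nome_mult_summable) (use q that in auto)
  have split: "theta_nome q * theta_nome (c * q) = S c + T c" if "c = 1 \<or> c = -1" for c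
  proof -
    have "theta_nome q * theta_nome (c * q) = infsum (h c) (even_pairs \<union> - even_pairs)"
      using theta_nome_mult_has_sum[of q "c * q"] q that
      unfolding h_def by (auto simp: infsumI)
    also have "\<dots> = S c + T c"
      unfolding S_def T_def by (rule infsum_Un_disjoint) (simp_all add: hs that)
    finally show ?thesis .
  qed
  have sq: "theta_nome (c * q ^ 2) ^ 2 = S c" if c: "c = 1 \<or> c = -1" for c
  proof -
    have "theta_nome (c * q ^ 2) ^ 2
        = infsum (\<lambda>(i, j). (c * q ^ 2) ^ nat (i ^ 2) * (c * q ^ 2) ^ nat (j ^ 2)) UNIV"
      using theta_nome_mult_has_sum[of "c * q ^ 2" "c * q ^ 2"] q2 c
      by (auto simp: infsumI power2_eq_square[of "theta_nome _"])
    also have "\<dots> = infsum (\<lambda>x. h c (case x of (i, j) \<Rightarrow> (i + j, i - j))) UNIV"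
    proof (intro infsum_cong, clarify)
      fix i j :: int
      \<comment> \<open>For \<open>c\<close> equal to 1 or -1 only the parity of its exponent
        matters.\<close>
      have "even (nat (i ^ 2) + nat (j ^ 2)) = even (nat ((i - j) ^ 2))"
        by (simp add: even_nat_iff)
      then have "c ^ (nat (i ^ 2) + nat (j ^ 2)) = c ^ nat ((i - j) ^ 2)"
        using c by (auto simp del: even_add simp: uminus_power_if)
      then show "(c * q ^ 2) ^ nat (i ^ 2) * (c * q ^ 2) ^ nat (j ^ 2) = h c (i + j, i - j)"
        unfolding power_nat_square_rotate h_def by (simp add: power_mult_distrib)
    qed
    also have "\<dots> = S c"
      unfolding S_def by (rule infsum_reindex_bij_betw[OF bij_betw_rotate])
    finally show ?thesis .
  qed
  \<comment> \<open>Swapping the coordinates preserves the complement and negates each term, so the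
    sum is its own negative.\<close>
  have "T (-1) = infsum (\<lambda>x. h (-1) (prod.swap x)) (- even_pairs)"
    unfolding T_def
    by (rule infsum_reindex_bij_betw[symmetric], rule bij_betwI[where g = prod.swap])
      (auto simp: even_pairs_def)
  also have "\<dots> = infsum (\<lambda>x. - h (-1) x) (- even_pairs)"
    by (intro infsum_cong) (auto simp: signs)
  also have "\<dots> = - T (-1)"
    by (simp add: T_def infsum_uminus)
  finally have T: "T (-1) = 0"
    by simp
  have "theta_nome (-q) ^ 2 = S 1 - T 1"
  proof -
    let ?g = "\<lambda>(m, n). (-q) ^ nat (m ^ 2) * (-q) ^ nat (n ^ 2)"
    have "theta_nome (-q) ^ 2 = infsum ?g (even_pairs \<union> - even_pairs)"
      using theta_nome_mult_has_sum[of "-q" "-q"] q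
      by (simp add: infsumI power2_eq_square[of "theta_nome _"])
    also have "\<dots> = infsum ?g even_pairs + infsum ?g (- even_pairs)"
      using q by (intro infsum_Un_disjoint theta_nome_mult_summable) auto
    also have "infsum ?g even_pairs = S 1"
      unfolding S_def by (intro infsum_cong) (auto simp: signs)
    also have "infsum ?g (- even_pairs) = infsum (\<lambda>x. - h 1 x) (- even_pairs)"
      by (intro infsum_cong) (auto simp: signs)
    also have "\<dots> = - T 1"
      by (simp add: T_def infsum_uminus)
    finally show ?thesis by simp
  qed
  then show "theta_nome (- (q ^ 2)) ^ 2 = theta_nome q * theta_nome (- q)"
    "2 * theta_nome (q ^ 2) ^ 2 = theta_nome q ^ 2 + theta_nome (- q) ^ 2"
    using split[of 1] split[of "-1"] sq[of 1] sq[of "-1"] T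
    by (simp_all add: power2_eq_square[of "theta_nome q"])
qed

section \<open>Holomorphy in the unit disc and the first two coefficients at 0\<close>

lemma theta_nome_uniform_limit:
  assumes "r < 1"
  shows "uniform_limit (cball 0 r) (\<lambda>X q. \<Sum>n\<in>X. q ^ nat (n ^ 2)) theta_nome
    (finite_subsets_at_top UNIV)"
proof (cases "r \<ge> 0")
  case True
  then show ?thesis
    unfolding theta_nome_def
    by (intro Weierstrass_m_test_general[where M = "\<lambda>n. r ^ nat (n ^ 2)"]
        summable_on_power_nat_square) (auto simp: norm_power assms intro!: power_mono)
qed (simp add: uniform_limit_iff)

lemma theta_nome_holomorphic: "theta_nome holomorphic_on ball 0 1"
proof -
  have "theta_nome holomorphic_on ball 0 r" if "r < 1" for r
    by (rule holomorphic_uniform_limit[OF _ theta_nome_uniform_limit[OF that]])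
      (auto intro!: always_eventually continuous_intros holomorphic_intros)
  then have "theta_nome holomorphic_on (\<Union>r\<in>{..<1}. ball 0 r)"
    by (intro holomorphic_on_UN_open) auto
  moreover have "ball (0::complex) 1 \<subseteq> (\<Union>r\<in>{..<1}. ball 0 r)"
  proof
    fix q :: complex assume "q \<in> ball 0 1"
    then obtain r where "norm q < r" "r < 1"
      using dense by auto
    then show "q \<in> (\<Union>r\<in>{..<1}. ball 0 r)"
      by auto
  qed
  ultimately show ?thesis
    using holomorphic_on_subset by blast
qed

lemma theta_nome_0: "theta_nome 0 = 1"
proof -
  have "theta_nome 0 = infsum (\<lambda>n::int. 1) {0}"
    unfolding theta_nome_def by (rule infsum_cong_neutral) (auto simp: power_0_left)
  then show ?thesis by simp
qed

text \<open>Derivatives pass to the locally uniform limit, and only the terms \<open>n = 1\<close>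
  and \<open>n = -1\<close> are linear in \<open>q\<close>.\<close>

lemma deriv_theta_nome_0: "deriv theta_nome 0 = 2"
proof -
  let ?F = "finite_subsets_at_top (UNIV :: int set)"
  have "((\<lambda>X. (deriv ^^ 1) (\<lambda>q. \<Sum>n\<in>X. q ^ nat (n ^ 2)) 0) \<longlongrightarrow> (deriv ^^ 1) theta_nome 0) ?F"
    by (rule higher_deriv_complex_uniform_limit[where A = "ball 0 (1/2)"])
      (auto intro!: always_eventually holomorphic_intros
        uniform_limit_on_subset[OF theta_nome_uniform_limit[of "1/2"]])
  moreover have "deriv (\<lambda>q. \<Sum>n\<in>X. q ^ nat (n ^ 2)) 0 = (2::complex)"
    if "finite X" "{1, -1} \<subseteq> X" for X :: "int set"
  proof -
    have "((\<lambda>q::complex. q ^ nat (n ^ 2)) has_field_derivative (if n \<in> {1, -1} then 1 else 0)) (at 0)"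
      for n :: int
    proof (cases "nat (n ^ 2) = 1")
      case True
      then show ?thesis
        by (auto intro!: derivative_eq_intros simp: nat_eq_iff power2_eq_1_iff)
    next
      case False
      then have "n \<notin> {1, -1}" by auto
      have *: "1 < nat (n ^ 2)" if "n \<noteq> 0"
      proof -
        have "n ^ 2 > 0" using that by simp
        then show ?thesis using False by linarith
      qed
      then show ?thesis
        using False \<open>n \<notin> {1, -1}\<close> by (cases "n = 0") (auto intro!: derivative_eq_intros simp: power_0_left *)
    qed
    then have "((\<lambda>q::complex. \<Sum>n\<in>X. q ^ nat (n ^ 2)) has_field_derivative
        (\<Sum>n\<in>X. if n \<in> {1, -1} then 1 else 0)) (at 0)"
      by (intro DERIV_sum) auto
    also have "(\<Sum>n\<in>X. if n \<in> {1, -1} then 1 else 0) = (\<Sum>n\<in>{1, -1::int}. 1::complex)"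
      using that by (intro sum.mono_neutral_cong_right) auto
    finally show ?thesis
      by (simp add: DERIV_imp_deriv)
  qed
  then have "\<forall>\<^sub>F X in ?F. deriv (\<lambda>q. \<Sum>n\<in>X. q ^ nat (n ^ 2)) 0 = (2::complex)"
    by (auto simp: eventually_finite_subsets_at_top intro!: exI[of _ "{1, -1}"])
  ultimately have "((\<lambda>X. 2::complex) \<longlongrightarrow> deriv theta_nome 0) ?F"
    by (auto elim: Lim_transform_eventually)
  then show ?thesis
    by (simp add: tendsto_const_iff)
qed

section \<open>Logarithmic derivatives along the iteration\<close>

lemma derivative_eq_on_open:
  assumes "open S" "x \<in> S" "\<And>y. y \<in> S \<Longrightarrow> f y = g y"
    and "(f has_field_derivative f') (at x)" "(g has_field_derivative g') (at x)"
  shows "f' = g'"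
  using assms DERIV_unique has_field_derivative_transform_within_open by metis

lemma filterlim_power_two_at_top: "filterlim (\<lambda>n. 2 ^ n :: nat) at_top sequentially"
  by (rule filterlim_at_top_mono[OF filterlim_ident])
    (auto intro!: always_eventually less_imp_le less_exp)

lemma filterlim_power_two_power_at_0:
  fixes q :: complex
  assumes "norm q < 1" "q \<noteq> 0"
  shows "filterlim (\<lambda>n. q ^ (2 ^ n)) (at 0) sequentially"
proof -
  have "(\<lambda>n. q ^ (2 ^ n)) \<longlonglongrightarrow> 0"
    using filterlim_power_two_at_top by (rule tendsto_power_zero) fact
  then show ?thesis
    using assms by (auto simp: filterlim_at)
qed

lemma power_two_power_Suc: "q ^ (2 ^ Suc n) = ((q::complex) ^ (2 ^ n)) ^ 2"
  by (simp add: mult.commute flip: power_mult)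

lemma norm_power_less_one:
  fixes q :: complex
  assumes "norm q < 1" "n > 0"
  shows "norm (q ^ n) < 1"
  using assms by (simp add: norm_power power_less_one_iff)

lemma theta_nome_field_derivative:
  assumes "norm q < 1"
  shows "(theta_nome has_field_derivative deriv theta_nome q) (at q)"
  using assms theta_nome_holomorphic by (intro holomorphic_derivI[where S = "ball 0 1"]) auto

text \<open>By the geometric mean relation a zero at \<open>- q\<close> forces zeros at all
  \<open>- (q ^ (2 ^ n))\<close>. These points tend to 0, where the value is 1.\<close>

lemma theta_nome_nonzero:
  assumes "norm q < 1"
  shows "theta_nome q \<noteq> 0"
proof -
  have neg: "theta_nome (-q) \<noteq> 0" if q: "norm q < 1" for q
  proof
    assume zero: "theta_nome (-q) = 0"
    have q0: "q \<noteq> 0"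
      using zero theta_nome_0 by auto
    have "theta_nome (- (q ^ (2 ^ n))) = 0" for n
    proof (induction n)
      case (Suc n)
      then show ?case
        using theta_nome_geometric_mean[of "q ^ (2 ^ n)"] norm_power_less_one[OF q, of "2 ^ n"]
        by (simp add: power_two_power_Suc del: power_Suc)
    qed (use zero in simp)
    moreover have "(\<lambda>n. theta_nome (- (q ^ (2 ^ n)))) \<longlonglongrightarrow> theta_nome (- 0)"
    proof (rule isCont_tendsto_compose[of "- 0" theta_nome])
      show "isCont theta_nome (- 0)"
        using theta_nome_field_derivative[of 0] by (simp add: DERIV_isCont)
      show "(\<lambda>n. - (q ^ (2 ^ n))) \<longlonglongrightarrow> - 0"
        using filterlim_power_two_power_at_0[OF q q0] by (intro tendsto_minus) (simp add: filterlim_at)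
    qed
    ultimately show False
      by (simp add: theta_nome_0 LIMSEQ_const_iff)
  qed
  show ?thesis
    using neg[of "-q"] assms by simp
qed

text \<open>This is \<open>P\<close> of the overview; \<open>R\<close> is its value at
  \<open>- q\<close>, since the two sign changes in \<open>D b\<close> combine.\<close>

definition theta_log_deriv :: "complex \<Rightarrow> complex" where
  "theta_log_deriv q = q * deriv theta_nome q / theta_nome q"

lemma euler_theta_nome:
  assumes "norm q < 1"
  shows "q * deriv theta_nome q = theta_nome q * theta_log_deriv q"
  using theta_nome_nonzero[OF assms] by (simp add: theta_log_deriv_def)

lemma theta_log_deriv_holomorphic: "theta_log_deriv holomorphic_on ball 0 1"
  unfolding theta_log_deriv_def
  by (intro holomorphic_intros theta_nome_holomorphic holomorphic_deriv) (auto simp: theta_nome_nonzero)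

lemma theta_log_deriv_field_derivative:
  assumes "norm q < 1"
  shows "(theta_log_deriv has_field_derivative deriv theta_log_deriv q) (at q)"
  using assms theta_log_deriv_holomorphic by (intro holomorphic_derivI[where S = "ball 0 1"]) auto

lemma theta_log_deriv_0: "theta_log_deriv 0 = 0"
  by (simp add: theta_log_deriv_def)

lemma deriv_theta_log_deriv_0: "deriv theta_log_deriv 0 = 2"
proof -
  have "(theta_nome has_field_derivative 2) (at 0)"
    using theta_nome_field_derivative[of 0] by (simp add: deriv_theta_nome_0)
  moreover have "(deriv theta_nome has_field_derivative deriv (deriv theta_nome) 0) (at 0)"
    by (intro holomorphic_derivI[where S = "ball 0 1"] holomorphic_deriv theta_nome_holomorphic) auto
  ultimately have "(theta_log_deriv has_field_derivative 2) (at 0)"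
    unfolding theta_log_deriv_def
    by (auto intro!: derivative_eq_intros simp: theta_nome_0 deriv_theta_nome_0)
  then show ?thesis
    by (rule DERIV_imp_deriv)
qed

section \<open>Logarithmic derivatives of the two mean relations\<close>

lemma field_derivative_reflect:
  assumes "(f has_field_derivative d) (at (- q))"
  shows "((\<lambda>q. f (- q)) has_field_derivative - d) (at (q :: complex))"
proof -
  have "((\<lambda>q. - q) has_field_derivative - 1) (at q)"
    by (auto intro!: derivative_eq_intros)
  from DERIV_chain2[OF assms this] show ?thesis
    by simp
qed

lemma field_derivative_square:
  assumes "(f has_field_derivative d) (at (c * q ^ 2))"
  shows "((\<lambda>q. f (c * q ^ 2)) has_field_derivative 2 * c * q * d) (at (q :: complex))"
proof -
  have "((\<lambda>q. c * q ^ 2) has_field_derivative 2 * c * q) (at q)"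
    by (auto intro!: derivative_eq_intros)
  from DERIV_chain2[OF assms this] show ?thesis
    by (simp add: mult_ac)
qed

text \<open>Take the logarithmic \<open>D\<close>-derivative of the geometric mean relation: the
  outer square and the inner \<open>q ^ 2\<close> contribute a factor 2 each.\<close>

lemma theta_log_deriv_minus_square:
  assumes q: "norm q < 1"
  shows "4 * theta_log_deriv (- (q ^ 2)) = theta_log_deriv q + theta_log_deriv (- q)"
proof -
  have q2: "norm (q ^ 2) < 1"
    using norm_power_less_one[OF q] by simp
  note d = theta_nome_field_derivative
  have "2 * theta_nome (- (q ^ 2)) * (- 2 * q * deriv theta_nome (- (q ^ 2)))
      = deriv theta_nome q * theta_nome (- q) - theta_nome q * deriv theta_nome (- q)"
  proof (rule derivative_eq_on_open[where S = "ball 0 1"])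
    show "((\<lambda>q. theta_nome (- (q ^ 2)) ^ 2) has_field_derivative
        2 * theta_nome (- (q ^ 2)) * (- 2 * q * deriv theta_nome (- (q ^ 2)))) (at q)"
      using field_derivative_square[of theta_nome _ "-1" q] d[of "- (q ^ 2)"] q2
      by (auto intro!: derivative_eq_intros)
    show "((\<lambda>q. theta_nome q * theta_nome (- q)) has_field_derivative
        deriv theta_nome q * theta_nome (- q) - theta_nome q * deriv theta_nome (- q)) (at q)"
      using d[of q] field_derivative_reflect[OF d, of q] q
      by (auto intro!: derivative_eq_intros)
  qed (use q in \<open>auto simp: theta_nome_geometric_mean\<close>)
  then have "4 * theta_nome (- (q ^ 2)) * (- (q ^ 2) * deriv theta_nome (- (q ^ 2)))
      = (q * deriv theta_nome q) * theta_nome (- q) + theta_nome q * (- q * deriv theta_nome (- q))"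
    by algebra
  moreover have "- (q ^ 2) * deriv theta_nome (- (q ^ 2)) = theta_nome (- (q ^ 2)) * theta_log_deriv (- (q ^ 2))"
    "q * deriv theta_nome q = theta_nome q * theta_log_deriv q"
    "- q * deriv theta_nome (- q) = theta_nome (- q) * theta_log_deriv (- q)"
    using q q2 by (simp_all only: euler_theta_nome norm_minus_cancel)
  ultimately have "4 * theta_nome (- (q ^ 2)) ^ 2 * theta_log_deriv (- (q ^ 2))
      = theta_nome q * theta_nome (- q) * (theta_log_deriv q + theta_log_deriv (- q))"
    by algebra
  then show ?thesis
    using q by (simp add: theta_nome_geometric_mean theta_nome_nonzero mult.left_commute)
qed

text \<open>Apply \<open>D\<close> to the arithmetic mean relation, then use that relation again to
  replace the square of the value at \<open>q ^ 2\<close>.\<close>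

lemma theta_log_deriv_square:
  assumes q: "norm q < 1"
  shows "4 * (theta_nome q ^ 2 + theta_nome (- q) ^ 2) * theta_log_deriv (q ^ 2)
    = 2 * (theta_nome q ^ 2 * theta_log_deriv q + theta_nome (- q) ^ 2 * theta_log_deriv (- q))"
proof -
  have q2: "norm (q ^ 2) < 1"
    using norm_power_less_one[OF q] by simp
  note d = theta_nome_field_derivative
  have "4 * theta_nome (q ^ 2) * (2 * q * deriv theta_nome (q ^ 2))
      = 2 * theta_nome q * deriv theta_nome q - 2 * theta_nome (- q) * deriv theta_nome (- q)"
  proof (rule derivative_eq_on_open[where S = "ball 0 1"])
    show "((\<lambda>q. 2 * theta_nome (q ^ 2) ^ 2) has_field_derivative
        4 * theta_nome (q ^ 2) * (2 * q * deriv theta_nome (q ^ 2))) (at q)"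
      using field_derivative_square[of theta_nome _ 1 q] d[of "q ^ 2"] q2
      by (auto intro!: derivative_eq_intros)
    show "((\<lambda>q. theta_nome q ^ 2 + theta_nome (- q) ^ 2) has_field_derivative
        2 * theta_nome q * deriv theta_nome q - 2 * theta_nome (- q) * deriv theta_nome (- q)) (at q)"
      using d[of q] field_derivative_reflect[OF d, of q] q
      by (auto intro!: derivative_eq_intros)
  qed (use q in \<open>auto simp: theta_nome_arithmetic_mean\<close>)
  then have "8 * theta_nome (q ^ 2) * (q ^ 2 * deriv theta_nome (q ^ 2))
      = 2 * theta_nome q * (q * deriv theta_nome q) + 2 * theta_nome (- q) * (- q * deriv theta_nome (- q))"
    by algebra
  moreover have "q ^ 2 * deriv theta_nome (q ^ 2) = theta_nome (q ^ 2) * theta_log_deriv (q ^ 2)"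
    "q * deriv theta_nome q = theta_nome q * theta_log_deriv q"
    "- q * deriv theta_nome (- q) = theta_nome (- q) * theta_log_deriv (- q)"
    using q q2 by (simp_all only: euler_theta_nome norm_minus_cancel)
  ultimately have "4 * (2 * theta_nome (q ^ 2) ^ 2) * theta_log_deriv (q ^ 2)
      = 2 * (theta_nome q ^ 2 * theta_log_deriv q + theta_nome (- q) ^ 2 * theta_log_deriv (- q))"
    by algebra
  then show ?thesis
    using q by (simp add: theta_nome_arithmetic_mean)
qed

section \<open>Fourth powers and the first-order relation\<close>

lemma theta_nome_pow4_square:
  assumes "norm q < 1"
  shows "4 * theta_nome (q ^ 2) ^ 4 = (theta_nome q ^ 2 + theta_nome (- q) ^ 2) ^ 2"
    and "theta_nome (- (q ^ 2)) ^ 4 = theta_nome q ^ 2 * theta_nome (- q) ^ 2"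
  using theta_nome_arithmetic_mean[OF assms] theta_nome_geometric_mean[OF assms] by algebra+

text \<open>By Jacobi's identity this is the fourth power of the theta constant
  \<open>theta_2\<close>.\<close>

definition theta_diff :: "complex \<Rightarrow> complex" where
  "theta_diff q = theta_nome q ^ 4 - theta_nome (- q) ^ 4"

lemma theta_diff_field_derivative:
  assumes "norm q < 1"
  shows "(theta_diff has_field_derivative 4 * theta_nome q ^ 3 * deriv theta_nome q
    + 4 * theta_nome (- q) ^ 3 * deriv theta_nome (- q)) (at q)"
  unfolding theta_diff_def
  using theta_nome_field_derivative[of q] field_derivative_reflect[OF theta_nome_field_derivative, of q] assms
  by (auto intro!: derivative_eq_intros simp: mult_ac)

lemma theta_diff_square:
  assumes "norm q < 1"
  shows "4 * theta_diff (q ^ 2) = (theta_nome q ^ 2 - theta_nome (- q) ^ 2) ^ 2"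
  unfolding theta_diff_def using theta_nome_pow4_square[OF assms] by algebra

text \<open>A zero at \<open>r\<close> passes to \<open>r ^ 2\<close>: the factor
  \<open>a^2 + b^2\<close> is twice a nonzero square, so \<open>a^2 - b^2\<close> vanishes. Zeros
  along the iteration contradict the simple zero at 0.\<close>

lemma theta_diff_nonzero:
  assumes q: "norm q < 1" "q \<noteq> 0"
  shows "theta_diff q \<noteq> 0"
proof
  assume zero: "theta_diff q = 0"
  have step: "theta_diff (r ^ 2) = 0" if r: "norm r < 1" "theta_diff r = 0" for r
  proof -
    have "(theta_nome r ^ 2 - theta_nome (- r) ^ 2) * (2 * theta_nome (r ^ 2) ^ 2) = 0"
      using r theta_nome_arithmetic_mean[OF r(1)] unfolding theta_diff_def by algebra
    moreover have "theta_nome (r ^ 2) \<noteq> 0"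
      using norm_power_less_one[OF r(1)] by (intro theta_nome_nonzero) simp
    ultimately have "theta_nome r ^ 2 - theta_nome (- r) ^ 2 = 0"
      by auto
    then show ?thesis
      using theta_diff_square[OF r(1)] by simp
  qed
  have "theta_diff (q ^ (2 ^ n)) = 0" for n
  proof (induction n)
    case (Suc n)
    then show ?case
      using step[OF norm_power_less_one[OF q(1), of "2 ^ n"]] by (simp add: power_two_power_Suc del: power_Suc)
  qed (use zero in simp)
  \<comment> \<open>From \<open>a = 1 + 2 q + ...\<close> the fourth powers are
    \<open>1 + 8 q + ...\<close> and \<open>1 - 8 q + ...\<close>, whence 16.\<close>
  moreover have "((\<lambda>h. theta_diff h / h) \<longlongrightarrow> 16) (at 0)"
    using theta_diff_field_derivative[of 0]
    by (simp add: DERIV_def theta_nome_0 deriv_theta_nome_0 theta_diff_def[of 0])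
  then have "(\<lambda>n. theta_diff (q ^ (2 ^ n)) / q ^ (2 ^ n)) \<longlonglongrightarrow> 16"
    by (rule filterlim_compose) (use q in \<open>rule filterlim_power_two_power_at_0\<close>)
  ultimately show False
    by (simp add: LIMSEQ_const_iff)
qed

text \<open>The difference of both sides, divided by \<^const>\<open>theta_diff\<close>, is invariant under
  \<open>q \<mapsto> q\<^sup>2\<close> and tends to \<open>0\<close> at \<open>0\<close>.\<close>

lemma theta_log_deriv_diff:
  assumes q: "norm q < 1"
  shows "4 * (theta_log_deriv q - theta_log_deriv (- q)) = theta_diff q"
proof (cases "q = 0")
  case True
  then show ?thesis by (simp add: theta_diff_def)
next
  case False
  define M where "M q = 4 * (theta_log_deriv q - theta_log_deriv (- q)) - theta_diff q" for q
  have step: "M (r ^ 2) / theta_diff (r ^ 2) = M r / theta_diff r" if r: "norm r < 1" "r \<noteq> 0" for r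
  proof -
    \<comment> \<open>From \<open>r\<close> to \<open>r ^ 2\<close> both \<open>M\<close> and
      \<open>theta_diff\<close> get multiplied by \<open>(a^2 - b^2) / (4 (a^2 + b^2))\<close>, so
      their quotient is unchanged.\<close>
    have *: "M (r ^ 2) * (4 * (theta_nome r ^ 2 + theta_nome (- r) ^ 2))
        = M r * (theta_nome r ^ 2 - theta_nome (- r) ^ 2)"
      using theta_diff_square[OF r(1)] theta_log_deriv_square[OF r(1)] theta_log_deriv_minus_square[OF r(1)]
      unfolding M_def theta_diff_def[of r] by algebra
    have nz: "theta_diff r \<noteq> 0" "theta_diff (r ^ 2) \<noteq> 0"
      using theta_diff_nonzero[OF r] theta_diff_nonzero[OF norm_power_less_one[OF r(1)], of 2] r by simp_all
    have W: "theta_diff r = (theta_nome r ^ 2 - theta_nome (- r) ^ 2) * (theta_nome r ^ 2 + theta_nome (- r) ^ 2)"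
      unfolding theta_diff_def by algebra
    define K where "K = theta_nome r ^ 2 + theta_nome (- r) ^ 2"
    have "K \<noteq> 0"
      using nz W by (auto simp: K_def)
    moreover have "M (r ^ 2) * theta_diff r * (4 * K) = M r * theta_diff (r ^ 2) * (4 * K)"
      using * W theta_diff_square[OF r(1)] unfolding K_def[symmetric] by algebra
    ultimately have "M (r ^ 2) * theta_diff r = M r * theta_diff (r ^ 2)"
      by simp
    then show ?thesis
      using nz by (simp add: field_simps)
  qed
  have iter: "M (q ^ (2 ^ n)) / theta_diff (q ^ (2 ^ n)) = M q / theta_diff q" for n
  proof (induction n)
    case (Suc n)
    then show ?case
      using step[of "q ^ (2 ^ n)"] norm_power_less_one[OF q, of "2 ^ n"] False
      by (simp add: power_two_power_Suc del: power_Suc)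
  qed simp
  have "((\<lambda>q. theta_log_deriv (- q)) has_field_derivative - 2) (at 0)"
    using field_derivative_reflect[of theta_log_deriv _ 0] theta_log_deriv_field_derivative[of 0]
    by (simp add: deriv_theta_log_deriv_0)
  moreover have "(theta_log_deriv has_field_derivative 2) (at 0)"
    using theta_log_deriv_field_derivative[of 0] by (simp add: deriv_theta_log_deriv_0)
  moreover have W': "(theta_diff has_field_derivative 16) (at 0)"
    using theta_diff_field_derivative[of 0] by (simp add: theta_nome_0 deriv_theta_nome_0)
  \<comment> \<open>The linear coefficients cancel, \<open>4 * (2 + 2) - 16 = 0\<close>.\<close>
  ultimately have "(M has_field_derivative 0) (at 0)"
    unfolding M_def by (auto intro!: derivative_eq_intros)
  then have "((\<lambda>h. (M h / h) / (theta_diff h / h)) \<longlongrightarrow> 0 / 16) (at 0)"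
    using W' by (intro tendsto_divide) (simp_all add: DERIV_def M_def[of 0] theta_diff_def[of 0])
  then have "(\<lambda>n. (M (q ^ (2 ^ n)) / q ^ (2 ^ n)) / (theta_diff (q ^ (2 ^ n)) / q ^ (2 ^ n))) \<longlonglongrightarrow> 0 / 16"
    by (rule filterlim_compose) (use q False in \<open>rule filterlim_power_two_power_at_0\<close>)
  then have "(\<lambda>n::nat. M q / theta_diff q) \<longlonglongrightarrow> 0"
    using False by (simp add: iter)
  then have "M q / theta_diff q = 0"
    by (simp add: LIMSEQ_const_iff)
  then show ?thesis
    using theta_diff_nonzero[OF q False] by (simp add: M_def)
qed

section \<open>The second-order relation\<close>

lemma euler_theta_log_deriv_diff:
  assumes q: "norm q < 1"
  shows "q * deriv theta_log_deriv q - (- q) * deriv theta_log_deriv (- q)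
    = theta_nome q ^ 4 * theta_log_deriv q - theta_nome (- q) ^ 4 * theta_log_deriv (- q)"
proof -
  note d = theta_log_deriv_field_derivative
  \<comment> \<open>Differentiate the first-order relation; multiplication by \<open>q\<close>
    afterwards turns all derivatives into \<open>D\<close>-derivatives at \<open>q\<close> and
    \<open>- q\<close>.\<close>
  have "4 * (deriv theta_log_deriv q + deriv theta_log_deriv (- q))
      = 4 * theta_nome q ^ 3 * deriv theta_nome q + 4 * theta_nome (- q) ^ 3 * deriv theta_nome (- q)"
  proof (rule derivative_eq_on_open[where S = "ball 0 1"])
    show "((\<lambda>q. 4 * (theta_log_deriv q - theta_log_deriv (- q))) has_field_derivative
        4 * (deriv theta_log_deriv q + deriv theta_log_deriv (- q))) (at q)"
      using d[of q] field_derivative_reflect[OF d, of q] q by (auto intro!: derivative_eq_intros)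
    show "(theta_diff has_field_derivative 4 * theta_nome q ^ 3 * deriv theta_nome q
        + 4 * theta_nome (- q) ^ 3 * deriv theta_nome (- q)) (at q)"
      using q by (rule theta_diff_field_derivative)
  qed (use q in \<open>auto simp: theta_log_deriv_diff simp del: right_diff_distrib_numeral\<close>)
  moreover have "- q * deriv theta_nome (- q) = theta_nome (- q) * theta_log_deriv (- q)"
    using q by (intro euler_theta_nome) simp
  ultimately show ?thesis
    using euler_theta_nome[OF q] by algebra
qed

text \<open>Apply \<open>D\<close> to the relation for \<open>theta_log_deriv (- (q ^ 2))\<close>;
  the inner square doubles the factor 4.\<close>

lemma euler_theta_log_deriv_minus_square:
  assumes q: "norm q < 1"
  shows "8 * (- (q ^ 2) * deriv theta_log_deriv (- (q ^ 2)))
    = q * deriv theta_log_deriv q + (- q) * deriv theta_log_deriv (- q)"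
proof -
  have q2: "norm (q ^ 2) < 1"
    using norm_power_less_one[OF q] by simp
  note d = theta_log_deriv_field_derivative
  have "4 * (- 2 * q * deriv theta_log_deriv (- (q ^ 2))) = deriv theta_log_deriv q - deriv theta_log_deriv (- q)"
  proof (rule derivative_eq_on_open[where S = "ball 0 1"])
    show "((\<lambda>q. 4 * theta_log_deriv (- (q ^ 2))) has_field_derivative
        4 * (- 2 * q * deriv theta_log_deriv (- (q ^ 2)))) (at q)"
      using field_derivative_square[of theta_log_deriv _ "-1" q] d[of "- (q ^ 2)"] q2
      by (auto intro!: derivative_eq_intros)
    show "((\<lambda>q. theta_log_deriv q + theta_log_deriv (- q)) has_field_derivative
        deriv theta_log_deriv q - deriv theta_log_deriv (- q)) (at q)"
      using d[of q] field_derivative_reflect[OF d, of q] q by (auto intro!: derivative_eq_intros)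
  qed (use q in \<open>auto simp: theta_log_deriv_minus_square\<close>)
  then show ?thesis
    by algebra
qed

text \<open>With \<open>q = p ^ 2\<close> the terms are squares of \<open>m * p ^ m\<close> at
  \<open>m = 2 ^ n\<close>, and \<open>m * p ^ m\<close> tends to 0.\<close>

lemma four_power_times_power_two_power_tendsto_0:
  fixes q :: complex
  assumes "norm q < 1"
  shows "(\<lambda>n. 4 ^ n * q ^ (2 ^ n)) \<longlonglongrightarrow> 0"
proof -
  define p where "p = csqrt q"
  have "norm p ^ 2 < 1 ^ 2"
    using assms by (simp add: p_def flip: norm_power)
  then have "norm p < 1"
    by (rule power_less_imp_less_base) simp
  then have "(\<lambda>n. of_nat n * p ^ n) \<longlonglongrightarrow> 0"
    by (rule powser_times_n_limit_0)
  then have "(\<lambda>n. of_nat (2 ^ n) * p ^ (2 ^ n)) \<longlonglongrightarrow> 0"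
    using filterlim_power_two_at_top by (rule filterlim_compose)
  then have "(\<lambda>n. (of_nat (2 ^ n) * p ^ (2 ^ n)) ^ 2) \<longlonglongrightarrow> 0 ^ 2"
    by (rule tendsto_power)
  moreover have "(of_nat (2 ^ n) * p ^ (2 ^ n)) ^ 2 = 4 ^ n * q ^ (2 ^ n)" for n
  proof -
    have "(p ^ (2 ^ n)) ^ 2 = (p ^ 2) ^ (2 ^ n)" "((2::complex) ^ n) ^ 2 = (2 ^ 2) ^ n"
      by (simp_all only: power_mult[symmetric] mult.commute)
    then show ?thesis
      by (simp add: p_def power_mult_distrib)
  qed
  ultimately show ?thesis
    by simp
qed

text \<open>The difference \<open>E\<close> of both sides satisfies \<open>E q = 4 E (q\<^sup>2)\<close>, which forces
  a function that is \<open>O(q)\<close> at \<open>0\<close> to vanish.\<close>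

lemma euler_theta_log_deriv:
  assumes q: "norm q < 1"
  shows "q * deriv theta_log_deriv q = 2 * theta_log_deriv q ^ 2 + theta_nome (- q) ^ 4 * theta_diff q / 8"
proof (cases "q = 0")
  case True
  then show ?thesis by (simp add: theta_diff_def theta_log_deriv_0)
next
  case False
  define E where "E q = q * deriv theta_log_deriv q - 2 * theta_log_deriv q ^ 2
    - theta_nome (- q) ^ 4 * theta_diff q / 8" for q
  have step: "E r = 4 * E (r ^ 2)" if r: "norm r < 1" for r
  proof -
    have r2: "norm (r ^ 2) < 1"
      using norm_power_less_one[OF r] by simp
    define a b L R d e where "a = theta_nome r" and "b = theta_nome (- r)"
      and "L = theta_log_deriv r" and "R = theta_log_deriv (- r)"
      and "d = r * deriv theta_log_deriv r" and "e = (- r) * deriv theta_log_deriv (- r)"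
    define a2 b2 L2 R2 d2 e2 where "a2 = theta_nome (r ^ 2)" and "b2 = theta_nome (- (r ^ 2))"
      and "L2 = theta_log_deriv (r ^ 2)" and "R2 = theta_log_deriv (- (r ^ 2))"
      and "d2 = r ^ 2 * deriv theta_log_deriv (r ^ 2)"
      and "e2 = - (r ^ 2) * deriv theta_log_deriv (- (r ^ 2))"
    note defs = a_def b_def L_def R_def d_def e_def a2_def b2_def L2_def R2_def d2_def e2_def
    \<comment> \<open>The relations between the values at \<open>r\<close> and at
      \<open>r ^ 2\<close> are all polynomial, so the functional equation for \<open>E\<close> is
      pure elimination.\<close>
    have "4 * a2 ^ 4 = (a ^ 2 + b ^ 2) ^ 2" "b2 ^ 4 = a ^ 2 * b ^ 2"
      using theta_nome_pow4_square[OF r] by (simp_all add: defs)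
    moreover have R: "R = L - (a ^ 4 - b ^ 4) / 4"
      using theta_log_deriv_diff[OF r] by (simp add: defs theta_diff_def field_simps)
    moreover have "L2 = R2 + (a2 ^ 4 - b2 ^ 4) / 4"
      using theta_log_deriv_diff[OF r2] by (simp add: defs theta_diff_def field_simps)
    moreover have "R2 = (L + R) / 4"
      using theta_log_deriv_minus_square[OF r] by (simp add: defs field_simps)
    moreover have "d - e = a ^ 4 * L - b ^ 4 * R"
      using euler_theta_log_deriv_diff[OF r] by (simp add: defs)
    moreover have "d2 - e2 = a2 ^ 4 * L2 - b2 ^ 4 * R2"
      using euler_theta_log_deriv_diff[OF r2] by (simp add: defs)
    moreover have "8 * e2 = d + e"
      using euler_theta_log_deriv_minus_square[OF r] by (simp add: defs)
    ultimately have "d - 2 * L ^ 2 - b ^ 4 * (a ^ 4 - b ^ 4) / 8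
        = 4 * (d2 - 2 * L2 ^ 2 - b2 ^ 4 * (a2 ^ 4 - b2 ^ 4) / 8)"
      by (simp add: field_simps) algebra
    then show ?thesis
      by (simp add: E_def defs theta_diff_def)
  qed
  have iter: "E q = 4 ^ n * E (q ^ (2 ^ n))" for n
  proof (induction n)
    case (Suc n)
    then show ?case
      using step[OF norm_power_less_one[OF q, of "2 ^ n"]] by (simp add: power_two_power_Suc del: power_Suc) simp
  qed simp
  have hol: "E holomorphic_on ball 0 1"
  proof -
    have "(\<lambda>q. theta_nome (- q)) holomorphic_on ball 0 1"
      by (rule holomorphic_on_compose_gen[OF _ theta_nome_holomorphic, unfolded o_def])
        (auto intro: holomorphic_intros)
    then show ?thesis
      unfolding E_def theta_diff_def
      by (intro holomorphic_intros theta_nome_holomorphic theta_log_deriv_holomorphic holomorphic_deriv) auto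
  qed
  then have "(E has_field_derivative deriv E 0) (at 0)"
    by (intro holomorphic_derivI[where S = "ball 0 1"]) auto
  \<comment> \<open>Since \<open>E 0 = 0\<close> the quotient converges, and multiplied by
    \<open>4 ^ n * q ^ (2 ^ n)\<close> it is the constant \<open>E q\<close> along the
    iteration.\<close>
  then have "((\<lambda>h. E h / h) \<longlongrightarrow> deriv E 0) (at 0)"
    by (simp add: DERIV_def E_def[of 0] theta_diff_def theta_log_deriv_0)
  then have "(\<lambda>n. E (q ^ (2 ^ n)) / q ^ (2 ^ n)) \<longlonglongrightarrow> deriv E 0"
    by (rule filterlim_compose) (use q False in \<open>rule filterlim_power_two_power_at_0\<close>)
  then have "(\<lambda>n. 4 ^ n * q ^ (2 ^ n) * (E (q ^ (2 ^ n)) / q ^ (2 ^ n))) \<longlonglongrightarrow> 0 * deriv E 0"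
    by (intro tendsto_mult four_power_times_power_two_power_tendsto_0 q)
  moreover have "4 ^ n * q ^ (2 ^ n) * (E (q ^ (2 ^ n)) / q ^ (2 ^ n)) = E q" for n
    using False iter[of n] by simp
  ultimately have "E q = 0"
    by (simp add: LIMSEQ_const_iff)
  then show ?thesis
    by (simp add: E_def algebra_simps)
qed

section \<open>The differential equation\<close>

definition euler_op :: "(complex \<Rightarrow> complex) \<Rightarrow> complex \<Rightarrow> complex" where
  "euler_op f q = q * deriv f q"

abbreviation theta_euler :: "nat \<Rightarrow> complex \<Rightarrow> complex" where
  "theta_euler k \<equiv> (euler_op ^^ k) theta_nome"

lemma theta_euler_holomorphic: "theta_euler k holomorphic_on ball 0 1"
  by (induction k) (auto simp: euler_op_def[abs_def] intro!: theta_nome_holomorphic holomorphic_intros holomorphic_deriv)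

lemma theta_euler_field_derivative:
  assumes "norm q < 1" "q \<noteq> 0"
  shows "(theta_euler k has_field_derivative theta_euler (Suc k) q / q) (at q)"
  using holomorphic_derivI[OF theta_euler_holomorphic[of k] open_ball, of q] assms
  by (simp add: euler_op_def)

lemma euler_op_eqI:
  assumes "\<And>r. norm r < 1 \<Longrightarrow> f r = g r" "(g has_field_derivative d) (at q)" "norm q < 1"
  shows "euler_op f q = q * d"
proof -
  have "(f has_field_derivative d) (at q)"
    using assms by (intro has_field_derivative_transform_within_open[of g d q "ball 0 1" f]) auto
  then show ?thesis
    by (simp add: euler_op_def DERIV_imp_deriv)
qed

text \<open>Since \<open>D\<close> preserves polynomials in \<open>a\<close>, \<open>b\<close> and
  \<open>P\<close>, every \<open>f k\<close> is such a polynomial. The combination of order three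
  turns out to be a multiple of the one of order two.\<close>

lemma theta_euler_ode:
  fixes q
  assumes q: "norm q < 1"
  defines "f \<equiv> \<lambda>k. theta_euler k q"
  shows "(f 0 ^ 2 * f 3 - 15 * f 0 * f 1 * f 2 + 30 * f 1 ^ 3) ^ 2 + 32 * (f 0 * f 2 - 3 * f 1 ^ 2) ^ 3
    = f 0 ^ 10 * (f 0 * f 2 - 3 * f 1 ^ 2) ^ 2"
proof -
  \<comment> \<open>The term of \<open>D P\<close> beyond \<open>2 P^2\<close>. With
    \<open>W\<close> an eighth of \<open>theta_diff\<close> it is \<open>b^4 W\<close>, and
    \<open>P - R\<close> becomes \<open>2 W\<close>.\<close>
  let ?T = "\<lambda>q. theta_nome (- q) ^ 4 * (theta_nome q ^ 4 - theta_nome (- q) ^ 4) / 8"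
  define a b L R W where "a = theta_nome q" and "b = theta_nome (- q)"
    and "L = theta_log_deriv q" and "R = theta_log_deriv (- q)" and "W = theta_diff q / 8"
  have W: "a ^ 4 = b ^ 4 + 8 * W"
    by (simp add: W_def a_def b_def theta_diff_def field_simps)
  have T: "?T q = b ^ 4 * W"
    by (simp add: W_def b_def theta_diff_def)
  have deriv_nome: "q * deriv theta_nome q = a * L" "- q * deriv theta_nome (- q) = b * R"
    using euler_theta_nome[of q] euler_theta_nome[of "- q"] q by (simp_all add: a_def b_def L_def R_def)
  have deriv_L: "q * deriv theta_log_deriv q = 2 * L ^ 2 + b ^ 4 * W"
    using euler_theta_log_deriv[OF q] by (simp add: L_def b_def W_def)
  have R: "R = L - 2 * W"
    using theta_log_deriv_diff[OF q] by (simp add: R_def L_def W_def field_simps)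
  note ders = theta_nome_field_derivative[OF q] theta_log_deriv_field_derivative[OF q]
    field_derivative_reflect[OF theta_nome_field_derivative, of q]
  have f1: "theta_euler 1 q = theta_nome q * theta_log_deriv q" if "norm q < 1" for q
    using euler_theta_nome[OF that] by (simp add: euler_op_def)
  have f2: "theta_euler 2 q = theta_nome q * (3 * theta_log_deriv q ^ 2 + ?T q)" if q: "norm q < 1" for q
  proof -
    have "theta_euler 2 q = euler_op (theta_euler 1) q"
      by (simp add: numeral_2_eq_2)
    also have "\<dots> = q * (theta_nome q * deriv theta_log_deriv q + deriv theta_nome q * theta_log_deriv q)"
    proof (rule euler_op_eqI)
      show "theta_euler 1 r = theta_nome r * theta_log_deriv r" if "norm r < 1" for r
        using that by (rule f1)
      show "((\<lambda>r. theta_nome r * theta_log_deriv r) has_field_derivative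
          theta_nome q * deriv theta_log_deriv q + deriv theta_nome q * theta_log_deriv q) (at q)"
        using theta_nome_field_derivative[OF q] theta_log_deriv_field_derivative[OF q]
        by (auto intro!: derivative_eq_intros)
    qed fact
    also have "\<dots> = theta_nome q * (3 * theta_log_deriv q ^ 2 + ?T q)"
      using euler_theta_nome[OF q] euler_theta_log_deriv[OF q] unfolding theta_diff_def by algebra
    finally show ?thesis .
  qed
  \<comment> \<open>This is \<open>D\<close> applied to \<open>?T\<close>, simplified by
    \<open>(L + R) / 2 = L - W\<close>.\<close>
  define V where "V = b ^ 4 * ((L - W) * a ^ 4 - R * b ^ 4)"
  have f3: "theta_euler 3 q = a * L * (3 * L ^ 2 + b ^ 4 * W) + a * (6 * L * (2 * L ^ 2 + b ^ 4 * W) + V)"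
  proof -
    let ?dT = "(- 4 * theta_nome (- q) ^ 3 * deriv theta_nome (- q) * (theta_nome q ^ 4 - theta_nome (- q) ^ 4)
      + theta_nome (- q) ^ 4 * (4 * theta_nome q ^ 3 * deriv theta_nome q
          + 4 * theta_nome (- q) ^ 3 * deriv theta_nome (- q))) / 8"
    have dT: "(?T has_field_derivative ?dT) (at q)"
      using ders q by (auto intro!: derivative_eq_intros)
    have "theta_euler 3 q = euler_op (theta_euler 2) q"
      by (simp add: numeral_3_eq_3 numeral_2_eq_2)
    also have "\<dots> = q * (deriv theta_nome q * (3 * theta_log_deriv q ^ 2 + ?T q)
        + theta_nome q * (6 * theta_log_deriv q * deriv theta_log_deriv q + ?dT))"
    proof (rule euler_op_eqI)
      show "theta_euler 2 r = theta_nome r * (3 * theta_log_deriv r ^ 2 + ?T r)" if "norm r < 1" for r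
        using that by (rule f2)
      show "((\<lambda>r. theta_nome r * (3 * theta_log_deriv r ^ 2 + ?T r)) has_field_derivative
          deriv theta_nome q * (3 * theta_log_deriv q ^ 2 + ?T q)
        + theta_nome q * (6 * theta_log_deriv q * deriv theta_log_deriv q + ?dT)) (at q)"
        by (rule derivative_eq_intros ders dT refl)+ simp
    qed fact
    also have "\<dots> = (q * deriv theta_nome q) * (3 * L ^ 2 + b ^ 4 * W)
        + a * (6 * L * (q * deriv theta_log_deriv q) + q * ?dT)"
      unfolding T by (simp add: a_def L_def algebra_simps)
    also have "q * ?dT = (4 * b ^ 3 * (- q * deriv theta_nome (- q)) * (a ^ 4 - b ^ 4)
        + b ^ 4 * (4 * a ^ 3 * (q * deriv theta_nome q) - 4 * b ^ 3 * (- q * deriv theta_nome (- q)))) / 8"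
      by (simp add: a_def b_def field_simps)
    also have "4 * b ^ 3 * (- q * deriv theta_nome (- q)) * (a ^ 4 - b ^ 4)
        + b ^ 4 * (4 * a ^ 3 * (q * deriv theta_nome q) - 4 * b ^ 3 * (- q * deriv theta_nome (- q))) = 8 * V"
      unfolding deriv_nome V_def R using W by algebra
    finally show ?thesis
      unfolding deriv_nome deriv_L by simp
  qed
  have f: "f 0 = a" "f 1 = a * L" "f 2 = a * (3 * L ^ 2 + b ^ 4 * W)"
    "f 3 = a * L * (3 * L ^ 2 + b ^ 4 * W) + a * (6 * L * (2 * L ^ 2 + b ^ 4 * W) + V)"
    using f1[OF q] f2[OF q, unfolded T] f3 by (simp_all add: f_def a_def L_def)
  define B where "B = f 0 * f 2 - 3 * f 1 ^ 2"
  have B: "B = a ^ 2 * b ^ 4 * W"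
    unfolding B_def f by algebra
  have A: "f 0 ^ 2 * f 3 - 15 * f 0 * f 1 * f 2 + 30 * f 1 ^ 3 = a * B * (2 * b ^ 4 - a ^ 4)"
    unfolding B f V_def R using W by algebra
  \<comment> \<open>After extraction of \<open>a^2 B^2\<close> the claim is
    \<open>(2 b^4 - a^4)^2 + 4 b^4 (a^4 - b^4) = a^8\<close>.\<close>
  have "32 * B = 4 * a ^ 2 * b ^ 4 * (a ^ 4 - b ^ 4)"
    unfolding B W by algebra
  then have "(a * B * (2 * b ^ 4 - a ^ 4)) ^ 2 + 32 * B ^ 3 = a ^ 10 * B ^ 2"
    by algebra
  then show ?thesis
    unfolding A unfolding B_def[symmetric] unfolding f(1) .
qed

section \<open>Transfer to the unit disc by the Cayley transform\<close>

lemma theta3_eq_theta_nome: "theta3 x = theta_nome (exp (- of_real pi * x))"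
proof -
  have "exp (- of_real pi * of_int n ^ 2 * x) = exp (- of_real pi * x) ^ nat (n ^ 2)" for n :: int
  proof -
    have "of_nat (nat (n ^ 2)) = (of_int n ^ 2 :: complex)"
      by (simp add: of_nat_nat)
    then show ?thesis
      by (simp add: mult_ac flip: exp_of_nat_mult)
  qed
  then show ?thesis
    by (simp add: theta3_def theta_nome_def)
qed

lemma Re_pos_of_norm_less_one:
  assumes "norm z < 1"
  shows "Re (1 + z) > 0"
  using abs_Re_le_cmod[of z] assms by simp

lemma one_plus_nonzero:
  assumes "norm z < 1"
  shows "1 + z \<noteq> (0 :: complex)"
  using Re_pos_of_norm_less_one[OF assms] by (metis less_irrefl zero_complex.sel(1))

lemma Re_cayley_pos:
  assumes "norm z < 1"
  shows "Re ((1 - z) / (1 + z)) > 0"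
proof -
  have "norm z ^ 2 < 1"
    using assms by (simp add: power_less_one_iff)
  moreover have "Re ((1 - z) / (1 + z)) = (1 - norm z ^ 2) / norm (1 + z) ^ 2"
    unfolding Re_divide cmod_power2 by (simp add: power2_eq_square algebra_simps)
  moreover have "1 + z \<noteq> 0"
    using assms by (rule one_plus_nonzero)
  ultimately show ?thesis
    by simp
qed

definition disc_nome :: "complex \<Rightarrow> complex" where
  "disc_nome z = exp (- of_real pi * ((1 - z) / (1 + z)))"

lemma norm_disc_nome:
  assumes "norm z < 1"
  shows "norm (disc_nome z) < 1"
proof -
  have "Re (- of_real pi * w) = - pi * Re w" for w
    by simp
  then show ?thesis
    unfolding disc_nome_def norm_exp_eq_Re using Re_cayley_pos[OF assms] by (simp only: exp_less_one_iff) simp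
qed

definition disc_factor :: "complex \<Rightarrow> complex" where
  "disc_factor z = 1 / csqrt (1 + z)"

lemma sigma3_eq: "sigma3 z = disc_factor z * theta_nome (disc_nome z)"
  by (simp add: sigma3_def theta3_eq_theta_nome disc_factor_def disc_nome_def)

text \<open>\<open>1 + z\<close> stays in the right half plane, off the branch cut. The cube keeps
  the derivative inside the powers of \<open>disc_factor\<close>.\<close>

lemma disc_factor_field_derivative:
  assumes "norm z < 1"
  shows "(disc_factor has_field_derivative - (disc_factor z ^ 3) / 2) (at z)"
proof -
  have nonpos: "1 + z \<notin> \<real>\<^sub>\<le>\<^sub>0"
    using Re_pos_of_norm_less_one[OF assms] by (auto simp: complex_nonpos_Reals_iff)
  moreover have "csqrt (1 + z) \<noteq> 0"
    using one_plus_nonzero[OF assms] by simp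
  ultimately show ?thesis
    unfolding disc_factor_def
    by (auto intro!: derivative_eq_intros simp: field_simps power2_eq_square power3_eq_cube)
qed

text \<open>The Cayley transform has derivative \<open>- 2 / (1 + z) ^ 2\<close>, and
  \<open>disc_factor z ^ 4\<close> is \<open>1 / (1 + z) ^ 2\<close>.\<close>

lemma disc_nome_field_derivative:
  assumes "norm z < 1"
  shows "(disc_nome has_field_derivative 2 * of_real pi * disc_factor z ^ 4 * disc_nome z) (at z)"
proof -
  have nz: "1 + z \<noteq> 0"
    using assms by (rule one_plus_nonzero)
  have "disc_factor z ^ 4 = (disc_factor z ^ 2) ^ 2"
    by simp
  then have s: "disc_factor z ^ 4 = 1 / (1 + z) ^ 2"
    by (simp add: disc_factor_def power_divide)
  have "((\<lambda>z. (1 - z) / (1 + z)) has_field_derivative - 2 / (1 + z) ^ 2) (at z)"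
    using nz by (auto intro!: derivative_eq_intros simp: field_simps power2_eq_square)
  from DERIV_fun_exp[OF DERIV_cmult[OF this, of "- of_real pi"]] show ?thesis
    unfolding s by (simp add: disc_nome_def[abs_def] mult_ac)
qed

text \<open>The linear span of these functions is closed under differentiation in \<open>z\<close>,
  and \<open>sigma3\<close> is the one with \<open>n = 1\<close> and \<open>k = 0\<close>.\<close>

definition sigma_monomial :: "nat \<Rightarrow> nat \<Rightarrow> complex \<Rightarrow> complex" where
  "sigma_monomial n k z = disc_factor z ^ n * theta_euler k (disc_nome z)"

lemma sigma_monomial_field_derivative:
  assumes "norm z < 1"
  shows "(sigma_monomial n k has_field_derivative
    2 * of_real pi * sigma_monomial (n + 4) (k + 1) z - of_nat n / 2 * sigma_monomial (n + 2) k z) (at z)"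
proof -
  have nz: "disc_nome z \<noteq> 0"
    by (simp add: disc_nome_def)
  have "((\<lambda>z. theta_euler k (disc_nome z)) has_field_derivative
      2 * of_real pi * disc_factor z ^ 4 * theta_euler (Suc k) (disc_nome z)) (at z)"
    using DERIV_chain2[OF theta_euler_field_derivative[OF norm_disc_nome[OF assms] nz]
        disc_nome_field_derivative[OF assms], of k] nz
    by (simp add: mult_ac)
  moreover have "((\<lambda>z. disc_factor z ^ n) has_field_derivative - of_nat n / 2 * disc_factor z ^ (n + 2)) (at z)"
  proof -
    \<comment> \<open>At \<open>n = 0\<close> the subtraction is truncated, but the factor
      \<open>of_nat n\<close> makes both sides 0.\<close>
    have eq: "of_nat n * (- (disc_factor z ^ 3) / 2 * disc_factor z ^ (n - Suc 0))
        = - of_nat n / 2 * disc_factor z ^ (n + 2)"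
      by (cases n) (simp_all add: power_add power3_eq_cube power2_eq_square algebra_simps)
    show ?thesis
      using DERIV_power[OF disc_factor_field_derivative[OF assms], of n] unfolding eq .
  qed
  ultimately have "((\<lambda>z. disc_factor z ^ n * theta_euler k (disc_nome z)) has_field_derivative
      - of_nat n / 2 * disc_factor z ^ (n + 2) * theta_euler k (disc_nome z)
      + 2 * of_real pi * disc_factor z ^ 4 * theta_euler (Suc k) (disc_nome z) * disc_factor z ^ n) (at z)"
    by (rule DERIV_mult[rotated])
  then show ?thesis
    unfolding sigma_monomial_def[abs_def] by (simp add: power_add mult_ac)
qed

lemma deriv_eqI_on_ball:
  fixes f g :: "complex \<Rightarrow> complex"
  assumes "\<And>w. norm w < 1 \<Longrightarrow> f w = g w" "(g has_field_derivative d) (at z)" "norm z < 1"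
  shows "deriv f z = d"
  using assms by (intro DERIV_imp_deriv has_field_derivative_transform_within_open[of g d z "ball 0 1" f]) auto

lemma sigma3_derivs:
  assumes z: "norm z < 1"
  defines "p \<equiv> complex_of_real pi" and "S \<equiv> sigma_monomial"
  shows "(sigma3 has_field_derivative 2 * p * S 5 1 z - 1 / 2 * S 3 0 z) (at z)"
    and "deriv sigma3 z = 2 * p * S 5 1 z - 1 / 2 * S 3 0 z"
    and "(deriv ^^ 2) sigma3 z = 4 * p ^ 2 * S 9 2 z - 6 * p * S 7 1 z + 3 / 4 * S 5 0 z"
    and "(deriv ^^ 3) sigma3 z = 8 * p ^ 3 * S 13 3 z - 30 * p ^ 2 * S 11 2 z
      + 45 / 2 * p * S 9 1 z - 15 / 8 * S 7 0 z"
proof -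
  \<comment> \<open>The shifted indices are separate variables so that the rule matches numerals;
    the sums are checked afterwards.\<close>
  have dS: "(S n k has_field_derivative 2 * p * S n' k' w - of_nat n / 2 * S m k w) (at w)"
    if "norm w < 1" "n' = n + 4" "k' = k + 1" "m = n + 2" for n k n' k' m w
    unfolding S_def p_def that(2-4) using that(1) by (rule sigma_monomial_field_derivative)
  have funpow: "(deriv ^^ 2) sigma3 = deriv (deriv sigma3)" "(deriv ^^ 3) sigma3 = deriv ((deriv ^^ 2) sigma3)"
    by (simp_all add: numeral_2_eq_2 numeral_3_eq_3)
  have S: "sigma3 = S 1 0"
    by (simp add: fun_eq_iff sigma3_eq S_def sigma_monomial_def)
  have d0: "(sigma3 has_field_derivative 2 * p * S 5 1 z - 1 / 2 * S 3 0 z) (at z)" if z: "norm z < 1" for z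
    unfolding S using dS[OF z, of 5 1 1 0 3] by simp
  have d1: "deriv sigma3 z = 2 * p * S 5 1 z - 1 / 2 * S 3 0 z" if z: "norm z < 1" for z
    using d0[OF z] by (rule DERIV_imp_deriv)
  have d2: "(deriv ^^ 2) sigma3 z = 4 * p ^ 2 * S 9 2 z - 6 * p * S 7 1 z + 3 / 4 * S 5 0 z"
    if z: "norm z < 1" for z
  proof -
    have "((\<lambda>z. 2 * p * S 5 1 z - 1 / 2 * S 3 0 z) has_field_derivative
        2 * p * (2 * p * S 9 2 z - of_nat 5 / 2 * S 7 1 z) - 1 / 2 * (2 * p * S 7 1 z - of_nat 3 / 2 * S 5 0 z)) (at z)"
      by (intro DERIV_diff DERIV_cmult dS z) simp_all
    from deriv_eqI_on_ball[OF d1 this z] show ?thesis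
      unfolding funpow(1) by (simp only:) (simp add: algebra_simps power2_eq_square)
  qed
  show "(sigma3 has_field_derivative 2 * p * S 5 1 z - 1 / 2 * S 3 0 z) (at z)"
    and "deriv sigma3 z = 2 * p * S 5 1 z - 1 / 2 * S 3 0 z"
    and "(deriv ^^ 2) sigma3 z = 4 * p ^ 2 * S 9 2 z - 6 * p * S 7 1 z + 3 / 4 * S 5 0 z"
    using d0[OF z] d1[OF z] d2[OF z] by this+
  show "(deriv ^^ 3) sigma3 z = 8 * p ^ 3 * S 13 3 z - 30 * p ^ 2 * S 11 2 z
      + 45 / 2 * p * S 9 1 z - 15 / 8 * S 7 0 z"
  proof -
    have "((\<lambda>z. 4 * p ^ 2 * S 9 2 z - 6 * p * S 7 1 z + 3 / 4 * S 5 0 z) has_field_derivative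
        4 * p ^ 2 * (2 * p * S 13 3 z - of_nat 9 / 2 * S 11 2 z) - 6 * p * (2 * p * S 11 2 z - of_nat 7 / 2 * S 9 1 z)
        + 3 / 4 * (2 * p * S 9 1 z - of_nat 5 / 2 * S 7 0 z)) (at z)"
      by (intro DERIV_add DERIV_diff DERIV_cmult dS z) simp_all
    from deriv_eqI_on_ball[OF d2 this z] show ?thesis
      unfolding funpow(2) by (simp only:) (simp add: algebra_simps power2_eq_square power3_eq_cube)
  qed
qed

theorem theorem11:
  shows "sigma3 holomorphic_on ball 0 1 \<and>
    (\<forall>z\<in>ball 0 1.
      let y = sigma3 z;
          y' = deriv sigma3 z;
          y'' = (deriv ^^ 2) sigma3 z;
          y''' = (deriv ^^ 3) sigma3 z
      in (y ^ 2 * y''' - 15 * y * y' * y'' + 30 * y' ^ 3) ^ 2 + 32 * (y * y'' - 3 * y' ^ 2) ^ 3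
         = 4 * of_real pi ^ 2 * y ^ 10 * (y * y'' - 3 * y' ^ 2) ^ 2)"
proof (intro conjI ballI)
  show "sigma3 holomorphic_on ball 0 1"
    using sigma3_derivs(1) by (subst holomorphic_on_open) (auto, blast)
next
  fix z :: complex
  assume "z \<in> ball 0 1"
  then have z: "norm z < 1"
    by simp
  define p where "p = complex_of_real pi"
  define s where "s = disc_factor z"
  define F where "F k = theta_euler k (disc_nome z)" for k
  define y y1 y2 y3 where "y = sigma3 z" and "y1 = deriv sigma3 z"
    and "y2 = (deriv ^^ 2) sigma3 z" and "y3 = (deriv ^^ 3) sigma3 z"
  \<comment> \<open>Denominators are cleared, which leaves polynomial relations with integer
    coefficients.\<close>
  have y: "y = s * F 0" "2 * y1 = 4 * p * s ^ 5 * F 1 - s ^ 3 * F 0"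
    "4 * y2 = 16 * p ^ 2 * s ^ 9 * F 2 - 24 * p * s ^ 7 * F 1 + 3 * s ^ 5 * F 0"
    "8 * y3 = 64 * p ^ 3 * s ^ 13 * F 3 - 240 * p ^ 2 * s ^ 11 * F 2 + 180 * p * s ^ 9 * F 1 - 15 * s ^ 7 * F 0"
    unfolding y_def y1_def y2_def y3_def sigma3_derivs(2-4)[OF z] s_def F_def p_def
    by (simp_all add: sigma3_eq sigma_monomial_def algebra_simps)
  define A B where "A = F 0 ^ 2 * F 3 - 15 * F 0 * F 1 * F 2 + 30 * F 1 ^ 3" and "B = F 0 * F 2 - 3 * F 1 ^ 2"
  have "A ^ 2 + 32 * B ^ 3 = F 0 ^ 10 * B ^ 2"
    using theta_euler_ode[OF norm_disc_nome[OF z]] by (simp add: A_def B_def F_def)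
  \<comment> \<open>This is the equation in the nome times
    \<open>64 * p ^ 6 * s ^ 30\<close>.\<close>
  then have "(8 * p ^ 3 * s ^ 15 * A) ^ 2 + 32 * (4 * p ^ 2 * s ^ 10 * B) ^ 3
      = 4 * p ^ 2 * (s * F 0) ^ 10 * (4 * p ^ 2 * s ^ 10 * B) ^ 2"
    by algebra
  \<comment> \<open>Covariance: the terms with lower powers of \<open>p\<close> and \<open>s\<close>
    cancel, here and in the second-order expression.\<close>
  moreover have "y ^ 2 * y3 - 15 * y * y1 * y2 + 30 * y1 ^ 3 = 8 * p ^ 3 * s ^ 15 * A"
    using y unfolding A_def by algebra
  moreover have "y * y2 - 3 * y1 ^ 2 = 4 * p ^ 2 * s ^ 10 * B"
    using y unfolding B_def by algebra
  ultimately have "(y ^ 2 * y3 - 15 * y * y1 * y2 + 30 * y1 ^ 3) ^ 2 + 32 * (y * y2 - 3 * y1 ^ 2) ^ 3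
      = 4 * p ^ 2 * y ^ 10 * (y * y2 - 3 * y1 ^ 2) ^ 2"
    by (simp only: y(1))
  then show "let y = sigma3 z; y' = deriv sigma3 z; y'' = (deriv ^^ 2) sigma3 z; y''' = (deriv ^^ 3) sigma3 z
      in (y ^ 2 * y''' - 15 * y * y' * y'' + 30 * y' ^ 3) ^ 2 + 32 * (y * y'' - 3 * y' ^ 2) ^ 3
         = 4 * of_real pi ^ 2 * y ^ 10 * (y * y'' - 3 * y' ^ 2) ^ 2"
    unfolding Let_def y_def y1_def y2_def y3_def p_def .
qed

end
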